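(* Let $n\ge1$, let $A\in\mathbb{H}^{n\times n}$ and $B\in\mathbb{H}^n$ be such that the pair $(A,B)$ is controllable, with controllability matrix $\mathcal{C}=[B,AB,\dots,A^{n-1}B]\in\mathbb{H}^{n\times n}$. Let $$a_d(\lambda)=d_0+d_1\lambda+\cdots+d_{n-1}\lambda^{n-1}+\lambda^n\in\mathbb{R}[\lambda]$$ be a monic polynomial with real coefficients, and let $e_n=[0,\dots,0,1]^{\top}\in\mathbb{R}^n$. Then the row vector $$K=e_n^{\top}\,\mathcal{C}^{-1}\,a_d(A)\in\mathbb{H}^{1\times n}$$ (state feedback $u=-Kx$) yields a closed-loop matrix $A_{\mathrm{cl}}=A-BK$ whose right spectrum is the set of similarity classes determined by the zeros of $a_d$: $$\sigma_r(A_{\mathrm{cl}})=\{[\lambda]:\lambda\in\mathbb{H},\ a_d(\lambda)=0\}.$$ Equivalently, if $\lambda_1,\dots,\lambda_m$ are representatives of the distinct similarity classes of zeros of $a_d$, then $\sigma_r(A_{\mathrm{cl}})=\{[\lambda_1],\dots,[\lambda_m]\}$.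
   Context: $\mathbb{H}$ denotes the real quaternions (noncommutative). Two quaternions $q,r$ are similar if $q=\alpha^{-1}r\alpha$ for some nonzero $\alpha\in\mathbb{H}$; $[q]$ denotes the similarity class of $q$. $(A,B)$ is controllable if the controllability matrix $\mathcal{C}$ is invertible over $\mathbb{H}$. For a real polynomial $p(\lambda)=\sum_kp_k\lambda^k\in\mathbb{R}[\lambda]$, $q\in\mathbb{H}$ and $M\in\mathbb{H}^{n\times n}$, $p(q)=\sum_kp_kq^k$ and $p(M)=\sum_kp_kM^k$ (with $M^0=I$); since the coefficients are real, hence central, the side on which they are written is irrelevant. For $M\in\mathbb{H}^{n\times n}$, the right spectrum is the set of similarity classes $\sigma_r(M)=\{[\lambda]:\exists\, v\in\mathbb{H}^n,\ v\neq0,\ Mv=v\lambda\}$. It is a set and does not record multiplicities (algebraic multiplicities are encoded by the polynomial $a_d$ itself). *)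

theory Defs
  imports
    Complex_Main
    "HOL-Computational_Algebra.Polynomial"
    "Jordan_Normal_Form.Matrix"
begin

datatype quat = Quat (qRe: real) (qI: real) (qJ: real) (qK: real)

lemma quat_eq_iff: "x = y \<longleftrightarrow> qRe x = qRe y \<and> qI x = qI y \<and> qJ x = qJ y \<and> qK x = qK y"
  by (auto intro: quat.expand)

lemma quat_eqI:
  "qRe x = qRe y \<Longrightarrow> qI x = qI y \<Longrightarrow> qJ x = qJ y \<Longrightarrow> qK x = qK y \<Longrightarrow> x = y"
  by (simp add: quat_eq_iff)

instantiation quat :: real_div_algebra
begin

definition zero_quat :: quat where "0 = Quat 0 0 0 0"

definition one_quat :: quat where "1 = Quat 1 0 0 0"

definition plus_quat :: "quat \<Rightarrow> quat \<Rightarrow> quat" where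
  "x + y = Quat (qRe x + qRe y) (qI x + qI y) (qJ x + qJ y) (qK x + qK y)"

definition uminus_quat :: "quat \<Rightarrow> quat" where
  "- x = Quat (- qRe x) (- qI x) (- qJ x) (- qK x)"

definition minus_quat :: "quat \<Rightarrow> quat \<Rightarrow> quat" where
  "x - y = Quat (qRe x - qRe y) (qI x - qI y) (qJ x - qJ y) (qK x - qK y)"

definition times_quat :: "quat \<Rightarrow> quat \<Rightarrow> quat" where
  "x * y = Quat
     (qRe x * qRe y - qI x * qI y - qJ x * qJ y - qK x * qK y)
     (qRe x * qI y + qI x * qRe y + qJ x * qK y - qK x * qJ y)
     (qRe x * qJ y - qI x * qK y + qJ x * qRe y + qK x * qI y)
     (qRe x * qK y + qI x * qJ y - qJ x * qI y + qK x * qRe y)"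

definition scaleR_quat :: "real \<Rightarrow> quat \<Rightarrow> quat" where
  "r *\<^sub>R x = Quat (r * qRe x) (r * qI x) (r * qJ x) (r * qK x)"

(* conjugate divided by squared norm *)
definition inverse_quat :: "quat \<Rightarrow> quat" where
  "inverse x = (let s = (qRe x)\<^sup>2 + (qI x)\<^sup>2 + (qJ x)\<^sup>2 + (qK x)\<^sup>2
     in Quat (qRe x / s) (- qI x / s) (- qJ x / s) (- qK x / s))"

definition divide_quat :: "quat \<Rightarrow> quat \<Rightarrow> quat" where
  "x div y = x * inverse y" for x y :: quat

lemmas quat_ops = zero_quat_def one_quat_def plus_quat_def uminus_quat_def minus_quat_def
  times_quat_def scaleR_quat_def

lemma quat_norm_sq_nonzero:
  assumes "x \<noteq> (0::quat)"
  shows "(qRe x)\<^sup>2 + (qI x)\<^sup>2 + (qJ x)\<^sup>2 + (qK x)\<^sup>2 \<noteq> 0"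
  using assms by (auto simp: quat_eq_iff zero_quat_def add_nonneg_eq_0_iff)

instance
proof
  fix x :: quat
  assume x: "x \<noteq> 0"
  note nz = quat_norm_sq_nonzero[OF x]
  show "inverse x * x = 1"
    using nz by (auto simp: inverse_quat_def Let_def quat_ops power2_eq_square
        simp flip: add_divide_distrib diff_divide_distrib)
  show "x * inverse x = 1"
    using nz by (auto simp: inverse_quat_def Let_def quat_ops power2_eq_square
        simp flip: add_divide_distrib diff_divide_distrib)
qed (auto simp: quat_ops inverse_quat_def divide_quat_def algebra_simps)

end

lemma quat_units:
  defines "i \<equiv> Quat 0 1 0 0" and "j \<equiv> Quat 0 0 1 0" and "k \<equiv> Quat 0 0 0 1"
  shows "i * i = -1" "j * j = -1" "k * k = -1" "i * j = k" "j * k = i" "k * i = j" "j * i = - k"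
  by (simp_all add: assms quat_ops)

lemma of_real_quat: "of_real r = Quat r 0 0 0"
  by (simp add: of_real_def quat_ops)

definition quat_similar :: "quat \<Rightarrow> quat \<Rightarrow> bool" where
  "quat_similar q r \<longleftrightarrow> (\<exists>\<alpha>. \<alpha> \<noteq> 0 \<and> q = inverse \<alpha> * r * \<alpha>)"

definition sim_class :: "quat \<Rightarrow> quat set" where
  "sim_class q = {r. quat_similar r q}"

(* The library's poly needs a commutative coefficient ring. *)
definition rpoly :: "real poly \<Rightarrow> quat \<Rightarrow> quat" where
  "rpoly p q = (\<Sum>k\<le>degree p. of_real (coeff p k) * q ^ k)"

(* Written entrywise because the matrix type, having no fixed dimensions, does not
   support finite sums of matrices. *)
definition rpoly_mat :: "real poly \<Rightarrow> quat mat \<Rightarrow> quat mat" where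
  "rpoly_mat p M = mat (dim_row M) (dim_col M)
     (\<lambda>(i, j). \<Sum>k\<le>degree p. of_real (coeff p k) * (M ^\<^sub>m k) $$ (i, j))"

definition ctrb_mat :: "quat mat \<Rightarrow> quat vec \<Rightarrow> quat mat" where
  "ctrb_mat A B = mat_of_cols (dim_row A) (map (\<lambda>k. A ^\<^sub>m k *\<^sub>v B) [0..<dim_row A])"

definition controllable :: "quat mat \<Rightarrow> quat vec \<Rightarrow> bool" where
  "controllable A B \<longleftrightarrow> invertible_mat (ctrb_mat A B)"

(* Two-sided inverse; meaningful only if invertible_mat M. *)
definition inv_mat :: "quat mat \<Rightarrow> quat mat" where
  "inv_mat M = (THE N. inverts_mat M N \<and> inverts_mat N M)"

lemma inv_mat_eqI:
  assumes MN: "inverts_mat M N" and NM: "inverts_mat N M"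
  shows "inv_mat M = N"
  unfolding inv_mat_def
proof (rule the_equality)
  show "inverts_mat M N \<and> inverts_mat N M" using assms by simp
next
  fix N' assume N': "inverts_mat M N' \<and> inverts_mat N' M"
  have carr: "Q \<in> carrier_mat (dim_col M) (dim_row M)"
    if "inverts_mat M Q" "inverts_mat Q M" for Q
    using that unfolding inverts_mat_def
    by (metis carrier_matI index_mult_mat(2,3) index_one_mat(2,3))
  have N: "N \<in> carrier_mat (dim_col M) (dim_row M)" and N'c: "N' \<in> carrier_mat (dim_col M) (dim_row M)"
    using carr assms N' by blast+
  have "N' = N' * (M * N)"
    using MN N'c by (simp add: inverts_mat_def)
  also have "\<dots> = (N' * M) * N"
    using N N'c by (intro assoc_mult_mat[symmetric]) auto
  also have "\<dots> = N"
    using N' N N'c by (simp add: inverts_mat_def)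
  finally show "N' = N" .
qed

(* Eigenvalues act on the right of the vector entries. *)
definition right_spectrum :: "quat mat \<Rightarrow> quat set set" where
  "right_spectrum M = {sim_class l | l.
     \<exists>v \<in> carrier_vec (dim_row M). v \<noteq> 0\<^sub>v (dim_row M) \<and> M *\<^sub>v v = map_vec (\<lambda>x. x * l) v}"

definition ackermann_gain :: "quat mat \<Rightarrow> quat vec \<Rightarrow> real poly \<Rightarrow> quat mat" where
  "ackermann_gain A B p =
     mat_of_row (unit_vec (dim_row A) (dim_row A - 1)) * inv_mat (ctrb_mat A B) * rpoly_mat p A"

end

theory Submission
  imports Defs
begin

text \<open>The row \<open>W = e\<^sub>n\<^sup>T C\<^sup>-\<^sup>1\<close> satisfies \<open>W A\<^sup>k B = 0\<close> for \<open>k < n - 1\<close> and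
  \<open>W A\<^sup>n\<^sup>-\<^sup>1 B = 1\<close>. Hence feedback does not change \<open>W A\<^sup>k\<close> for \<open>k < n\<close>, and with \<open>K = W a(A)\<close>
  the closed-loop matrix \<open>M\<close> satisfies \<open>W a(M) = 0\<close>; moreover a vector annihilated by all
  \<open>W A\<^sup>k\<close>, \<open>k < n\<close>, is zero. If \<open>M v = v l\<close>, then \<open>0 = W a(M) v = (W v) a(l)\<close>, while \<open>W v = 0\<close>
  would force \<open>v = 0\<close>. Conversely \<open>a(M) B = 0\<close>, so that dividing \<open>a(x) - a(l)\<close> by \<open>x - l\<close>
  yields an eigenvector for every root \<open>l\<close>. Right multiplication by quaternions commutes with
  matrices, and the coefficients of \<open>a\<close> are central, so noncommutativity does no harm.\<close>

section \<open>Vectors as a right module over the scalars\<close>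

lemma of_real_commute: "of_real r * (x::'a::real_algebra_1) = x * of_real r"
  by (simp add: of_real_def)

definition scale_right :: "'a::semiring_0 vec \<Rightarrow> 'a \<Rightarrow> 'a vec" where
  "scale_right v q = map_vec (\<lambda>x. x * q) v"

lemma scale_right_simps [simp]:
  "dim_vec (scale_right v q) = dim_vec v"
  "scale_right v q \<in> carrier_vec n \<longleftrightarrow> v \<in> carrier_vec n"
  "i < dim_vec v \<Longrightarrow> scale_right v q $ i = v $ i * q"
  by (simp_all add: scale_right_def)

lemma scale_right_one [simp]: "scale_right v (1::'a::semiring_1) = v"
  by (intro eq_vecI) auto

lemma scale_right_scale_right [simp]: "scale_right (scale_right v p) q = scale_right v (p * q)"
  by (intro eq_vecI) (auto simp: mult.assoc)

lemma mult_mat_vec_nth: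
  "\<lbrakk>M \<in> carrier_mat r n; v \<in> carrier_vec n; i < r\<rbrakk> \<Longrightarrow> (M *\<^sub>v v) $ i = (\<Sum>j<n. M $$ (i, j) * v $ j)"
  by (auto simp: scalar_prod_def atLeast0LessThan intro!: sum.cong)

lemma mult_mat_vec_scale_right:
  "\<lbrakk>M \<in> carrier_mat r n; v \<in> carrier_vec n\<rbrakk> \<Longrightarrow> M *\<^sub>v scale_right v q = scale_right (M *\<^sub>v v) q"
  by (intro eq_vecI) (auto simp: mult_mat_vec_nth sum_distrib_right mult.assoc simp del: index_mult_mat_vec)

text \<open>The explicit dimension \<open>n\<close> makes the empty combination the zero vector of
  the right length.\<close>

definition right_comb :: "nat \<Rightarrow> nat \<Rightarrow> (nat \<Rightarrow> 'a::semiring_0 vec) \<Rightarrow> (nat \<Rightarrow> 'a) \<Rightarrow> 'a vec" where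
  "right_comb n m g c = vec n (\<lambda>i. \<Sum>j<m. g j $ i * c j)"

lemma right_comb_simps [simp]:
  "dim_vec (right_comb n m g c) = n"
  "right_comb n m g c \<in> carrier_vec n"
  "i < n \<Longrightarrow> right_comb n m g c $ i = (\<Sum>j<m. g j $ i * c j)"
  by (simp_all add: right_comb_def)

text \<open>Matrix entries act from the left and coefficients from the right, so associativity alone
  gives linearity.\<close>

lemma mult_mat_vec_right_comb:
  assumes M: "M \<in> carrier_mat r n" and g: "\<And>j. j < m \<Longrightarrow> g j \<in> carrier_vec n"
  shows "M *\<^sub>v right_comb n m g c = right_comb r m (\<lambda>j. M *\<^sub>v g j) c"
proof (intro eq_vecI)
  fix i assume "i < dim_vec (right_comb r m (\<lambda>j. M *\<^sub>v g j) c)"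
  then have i: "i < r" by simp
  have "(M *\<^sub>v right_comb n m g c) $ i = (\<Sum>k<n. \<Sum>j<m. M $$ (i, k) * (g j $ k * c j))"
    using i by (simp add: mult_mat_vec_nth[OF M] sum_distrib_left del: index_mult_mat_vec)
  also have "\<dots> = (\<Sum>j<m. (M *\<^sub>v g j) $ i * c j)"
    using i g by (subst sum.swap)
      (simp add: mult_mat_vec_nth[OF M] sum_distrib_right mult.assoc del: index_mult_mat_vec)
  finally show "(M *\<^sub>v right_comb n m g c) $ i = right_comb r m (\<lambda>j. M *\<^sub>v g j) c $ i"
    using i by simp
qed (use M in auto)

lemma mat_of_cols_mult_vec:
  assumes "\<And>j. j < m \<Longrightarrow> g j \<in> carrier_vec n" "x \<in> carrier_vec m"
  shows "mat_of_cols n (map g [0..<m]) *\<^sub>v x = right_comb n m g (($) x)"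
proof (intro eq_vecI)
  have C: "mat_of_cols n (map g [0..<m]) \<in> carrier_mat n m"
    by (metis length_map length_upt minus_nat.diff_0 mat_of_cols_carrier(1))
  fix i assume "i < dim_vec (right_comb n m g (($) x))"
  then have i: "i < n" by simp
  show "(mat_of_cols n (map g [0..<m]) *\<^sub>v x) $ i = right_comb n m g (($) x) $ i"
    using i assms by (simp add: mult_mat_vec_nth[OF C] mat_of_cols_index del: index_mult_mat_vec)
qed simp

section \<open>Matrix polynomials, inverses and powers acting on vectors\<close>

lemma rpoly_mat_carrier [simp]: "M \<in> carrier_mat n n \<Longrightarrow> rpoly_mat p M \<in> carrier_mat n n"
  by (simp add: rpoly_mat_def)

text \<open>Real coefficients are central, so they may move to the right of the vector
  entries.\<close>

lemma rpoly_mat_mult_vec: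
  assumes M: "M \<in> carrier_mat n n" and v: "v \<in> carrier_vec n"
  shows "rpoly_mat p M *\<^sub>v v =
    right_comb n (Suc (degree p)) (\<lambda>k. M ^\<^sub>m k *\<^sub>v v) (\<lambda>k. of_real (coeff p k))"
proof (intro eq_vecI)
  fix i assume "i < dim_vec (right_comb n (Suc (degree p)) (\<lambda>k. M ^\<^sub>m k *\<^sub>v v) (\<lambda>k. of_real (coeff p k)))"
  then have i: "i < n" by simp
  have Mk: "M ^\<^sub>m k \<in> carrier_mat n n" for k using M by (rule pow_carrier_mat)
  have "(rpoly_mat p M *\<^sub>v v) $ i =
      (\<Sum>j<n. \<Sum>k\<le>degree p. of_real (coeff p k) * (M ^\<^sub>m k) $$ (i, j) * v $ j)"
    using i M by (simp only: mult_mat_vec_nth[OF rpoly_mat_carrier[OF M] v])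
      (simp add: rpoly_mat_def sum_distrib_right)
  also have "\<dots> = (\<Sum>k\<le>degree p. of_real (coeff p k) * (M ^\<^sub>m k *\<^sub>v v) $ i)"
    using i by (subst sum.swap)
      (simp add: mult_mat_vec_nth[OF Mk v] sum_distrib_left mult.assoc del: index_mult_mat_vec)
  finally show "(rpoly_mat p M *\<^sub>v v) $ i =
      right_comb n (Suc (degree p)) (\<lambda>k. M ^\<^sub>m k *\<^sub>v v) (\<lambda>k. of_real (coeff p k)) $ i"
    using i by (simp add: of_real_commute lessThan_Suc_atMost)
qed (use rpoly_mat_carrier[OF M, of p] in auto)

lemma inv_mat_invertible:
  assumes "invertible_mat M"
  shows "inverts_mat M (inv_mat M)" "inverts_mat (inv_mat M) M"
  using assms inv_mat_eqI unfolding invertible_mat_def by metis+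

lemma pow_mat_mult_vec_carrier:
  "M \<in> carrier_mat n n \<Longrightarrow> v \<in> carrier_vec n \<Longrightarrow> M ^\<^sub>m k *\<^sub>v v \<in> carrier_vec n"
  by (meson mult_mat_vec_carrier pow_carrier_mat)

lemma pow_mat_mult_vec_add:
  assumes "M \<in> carrier_mat n n" "v \<in> carrier_vec n"
  shows "M ^\<^sub>m i *\<^sub>v (M ^\<^sub>m k *\<^sub>v v) = M ^\<^sub>m (i + k) *\<^sub>v v"
  using assms(2)
proof (induction k arbitrary: v)
  case (Suc k)
  \<comment> \<open>The new factor of the power stands next to \<open>v\<close>, hence the induction
    over arbitrary \<open>v\<close>.\<close>
  have "M ^\<^sub>m Suc j *\<^sub>v v = M ^\<^sub>m j *\<^sub>v (M *\<^sub>v v)" for j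
    by (simp add: assoc_mult_mat_vec[OF pow_carrier_mat[OF assms(1)] assms(1) Suc.prems])
  then show ?case
    using Suc.IH[of "M *\<^sub>v v"] assms(1) Suc.prems by (simp del: pow_mat.simps)
qed (use assms in simp)

lemma pow_mat_eigenvector:
  assumes M: "M \<in> carrier_mat n n" and v: "v \<in> carrier_vec n" and eig: "M *\<^sub>v v = scale_right v l"
  shows "M ^\<^sub>m k *\<^sub>v v = scale_right v (l ^ k)"
proof (induction k)
  case (Suc k)
  have Mk: "M ^\<^sub>m k \<in> carrier_mat n n" using M by (rule pow_carrier_mat)
  have "M ^\<^sub>m Suc k *\<^sub>v v = M ^\<^sub>m k *\<^sub>v scale_right v l"
    using M v Mk eig by (simp add: assoc_mult_mat_vec[OF Mk M v])
  also have "\<dots> = scale_right v (l ^ Suc k)"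
    using Mk v Suc by (simp add: mult_mat_vec_scale_right[OF Mk v] power_commutes)
  finally show ?case .
qed (use M v in simp)

section \<open>The closed loop and the output row \<open>W\<close>\<close>

locale ackermann =
  fixes n :: nat and A :: "quat mat" and B :: "quat vec" and a :: "real poly"
  assumes n: "n \<ge> 1"
    and A: "A \<in> carrier_mat n n"
    and B: "B \<in> carrier_vec n"
    and ctrb: "controllable A B"
    and deg: "degree a = n" and monic: "lead_coeff a = 1"
begin

text \<open>Applied to a vector, this row reads off its coordinate along \<open>A^(n-1) B\<close> in
  the basis of columns of the controllability matrix.\<close>

definition W :: "quat mat" where
  "W = mat_of_row (unit_vec n (n - 1)) * inv_mat (ctrb_mat A B)"

definition Acl :: "quat mat" where
  "Acl = A - mat_of_cols n [B] * ackermann_gain A B a"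

text \<open>The k-th output of the system with state matrix \<open>M\<close> and output row
  \<open>W\<close>; index 0 is the only entry.\<close>

definition observed :: "quat mat \<Rightarrow> nat \<Rightarrow> quat vec \<Rightarrow> quat" where
  "observed M k v = (W *\<^sub>v (M ^\<^sub>m k *\<^sub>v v)) $ 0"

lemma ctrb_mat_carrier: "ctrb_mat A B \<in> carrier_mat n n"
  using A mat_of_cols_carrier(1)[of n "map (\<lambda>k. A ^\<^sub>m k *\<^sub>v B) [0..<n]"]
  by (simp add: ctrb_mat_def)

lemma inv_ctrb:
  "inv_mat (ctrb_mat A B) \<in> carrier_mat n n"
  "ctrb_mat A B * inv_mat (ctrb_mat A B) = 1\<^sub>m n"
  "inv_mat (ctrb_mat A B) * ctrb_mat A B = 1\<^sub>m n"
proof -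
  let ?C = "ctrb_mat A B"
  have inv: "inverts_mat ?C (inv_mat ?C)" "inverts_mat (inv_mat ?C) ?C"
    using ctrb inv_mat_invertible by (auto simp: controllable_def)
  have CN: "?C * inv_mat ?C = 1\<^sub>m n" and NC: "inv_mat ?C * ?C = 1\<^sub>m (dim_row (inv_mat ?C))"
    using inv ctrb_mat_carrier by (auto simp: inverts_mat_def)
  \<comment> \<open>\<open>inverts_mat\<close> fixes no shape for the inverse; comparing column
    counts in the two identities does.\<close>
  have "dim_col (inv_mat ?C) = n"
    using arg_cong[OF CN, of dim_col] by simp
  moreover have "dim_row (inv_mat ?C) = n"
    using arg_cong[OF NC, of dim_col] ctrb_mat_carrier by simp
  ultimately show "inv_mat ?C \<in> carrier_mat n n" by auto
  then show "?C * inv_mat ?C = 1\<^sub>m n" "inv_mat ?C * ?C = 1\<^sub>m n" using CN NC by auto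
qed

lemma W: "W \<in> carrier_mat 1 n"
  using inv_ctrb(1) by (auto simp: W_def)

lemma gain: "ackermann_gain A B a = W * rpoly_mat a A"
  using A by (simp add: ackermann_gain_def W_def)

lemma gain_carrier: "ackermann_gain A B a \<in> carrier_mat 1 n"
  using W A by (simp add: gain)

lemma Acl: "Acl \<in> carrier_mat n n"
  using A gain_carrier by (auto simp: Acl_def)

lemma observed_right_comb:
  assumes M: "M \<in> carrier_mat n n" and g: "\<And>j. j < m \<Longrightarrow> g j \<in> carrier_vec n"
  shows "observed M k (right_comb n m g c) = (\<Sum>j<m. observed M k (g j) * c j)"
proof -
  have Mk: "M ^\<^sub>m k \<in> carrier_mat n n" using M by (rule pow_carrier_mat)
  show ?thesis
    using assms W by (simp add: observed_def mult_mat_vec_right_comb[OF Mk g]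
      mult_mat_vec_right_comb[OF W] pow_mat_mult_vec_carrier del: index_mult_mat_vec)
qed

lemma observed_scale_right:
  assumes M: "M \<in> carrier_mat n n" and v: "v \<in> carrier_vec n"
  shows "observed M k (scale_right v q) = observed M k v * q"
proof -
  have Mk: "M ^\<^sub>m k \<in> carrier_mat n n" using M by (rule pow_carrier_mat)
  show ?thesis
    using W by (simp add: observed_def mult_mat_vec_scale_right[OF Mk v]
      mult_mat_vec_scale_right[OF W] pow_mat_mult_vec_carrier[OF M v] del: index_mult_mat_vec)
qed

lemma observed_diff:
  assumes M: "M \<in> carrier_mat n n" and v: "v \<in> carrier_vec n" "u \<in> carrier_vec n"
  shows "observed M k (v - u) = observed M k v - observed M k u"
proof -
  have Mk: "M ^\<^sub>m k \<in> carrier_mat n n" using M by (rule pow_carrier_mat)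
  show ?thesis
    using W by (simp add: observed_def mult_minus_distrib_mat_vec[OF Mk v]
      mult_minus_distrib_mat_vec[OF W] pow_mat_mult_vec_carrier[OF M] v del: index_mult_mat_vec)
qed

lemma observed_pow:
  "\<lbrakk>M \<in> carrier_mat n n; v \<in> carrier_vec n\<rbrakk> \<Longrightarrow> observed M i (M ^\<^sub>m k *\<^sub>v v) = observed M (i + k) v"
  by (simp add: observed_def pow_mat_mult_vec_add)

lemma observed_Suc:
  "\<lbrakk>M \<in> carrier_mat n n; v \<in> carrier_vec n\<rbrakk> \<Longrightarrow> observed M (Suc k) v = observed M k (M *\<^sub>v v)"
  using observed_pow[of M v k 1] by simp

section \<open>Outputs with and without feedback; observability\<close>

lemma observed_B:
  assumes "k < n"
  shows "observed A k B = (if k = n - 1 then 1 else 0)"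
proof -
  let ?C = "ctrb_mat A B"
  have "A ^\<^sub>m k *\<^sub>v B = col ?C k"
    using assms A pow_mat_mult_vec_carrier[OF A B] by (simp add: ctrb_mat_def col_mat_of_cols)
  then have "W *\<^sub>v (A ^\<^sub>m k *\<^sub>v B) = col (W * ?C) k"
    using assms ctrb_mat_carrier by (intro eq_vecI) auto
  \<comment> \<open>The sought value is thus entry \<open>k\<close> of the last row of the identity
    matrix.\<close>
  also have "W * ?C = mat_of_row (unit_vec n (n - 1)) * (inv_mat ?C * ?C)"
    unfolding W_def using inv_ctrb(1) ctrb_mat_carrier
    by (intro assoc_mult_mat) auto
  also have "\<dots> = mat_of_row (unit_vec n (n - 1))"
    by (simp add: inv_ctrb(3))
  finally show ?thesis
    using assms n by (auto simp: observed_def mat_of_row_def)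
qed

lemma observed_gain:
  assumes v: "v \<in> carrier_vec n"
  shows "(ackermann_gain A B a *\<^sub>v v) $ 0 = (\<Sum>k\<le>n. observed A k v * of_real (coeff a k))"
proof -
  have "ackermann_gain A B a *\<^sub>v v = W *\<^sub>v (rpoly_mat a A *\<^sub>v v)"
    unfolding gain using W A v by (intro assoc_mult_mat_vec) auto
  also have "\<dots> = right_comb 1 (Suc n) (\<lambda>k. W *\<^sub>v (A ^\<^sub>m k *\<^sub>v v)) (\<lambda>k. of_real (coeff a k))"
    using A v by (simp add: rpoly_mat_mult_vec deg mult_mat_vec_right_comb[OF W] pow_mat_mult_vec_carrier)
  finally show ?thesis
    by (simp add: observed_def lessThan_Suc_atMost del: index_mult_mat_vec)
qed

lemma Acl_mult_vec:
  assumes v: "v \<in> carrier_vec n"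
  shows "Acl *\<^sub>v v = A *\<^sub>v v - scale_right B ((ackermann_gain A B a *\<^sub>v v) $ 0)"
proof -
  let ?K = "ackermann_gain A B a"
  have BC: "mat_of_cols n [B] \<in> carrier_mat n 1" by auto
  have "Acl *\<^sub>v v = A *\<^sub>v v - (mat_of_cols n [B] * ?K) *\<^sub>v v"
    unfolding Acl_def using A gain_carrier v by (intro minus_mult_distrib_mat_vec) auto
  also have "(mat_of_cols n [B] * ?K) *\<^sub>v v = mat_of_cols n [B] *\<^sub>v (?K *\<^sub>v v)"
    using BC gain_carrier v by (rule assoc_mult_mat_vec)
  also have "\<dots> = scale_right B ((?K *\<^sub>v v) $ 0)"
    using B mult_mat_vec_carrier[OF gain_carrier v]
    by (intro eq_vecI)
      (auto simp: mult_mat_vec_nth[OF BC] mat_of_cols_index simp del: index_mult_mat_vec)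
  finally show ?thesis .
qed

lemma observed_Acl_step:
  assumes v: "v \<in> carrier_vec n"
  shows "observed A k (Acl *\<^sub>v v) =
    observed A (Suc k) v - observed A k B * (ackermann_gain A B a *\<^sub>v v) $ 0"
  using A B v mult_mat_vec_carrier[OF A v]
  by (simp add: Acl_mult_vec observed_diff observed_scale_right observed_Suc del: index_mult_mat_vec)

text \<open>In each step the feedback enters through \<open>observed A k B\<close> with
  \<open>Suc k < n\<close>, which is 0.\<close>

lemma observed_Acl:
  "k < n \<Longrightarrow> v \<in> carrier_vec n \<Longrightarrow> observed Acl k v = observed A k v"
proof (induction k arbitrary: v)
  case 0
  then show ?case using A Acl by (simp add: observed_def)
next
  case (Suc k)
  have "observed Acl (Suc k) v = observed A k (Acl *\<^sub>v v)"
    using Suc Acl by (simp add: observed_Suc mult_mat_vec_carrier[OF Acl])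
  then show ?case
    using observed_Acl_step[OF Suc.prems(2), of k] observed_B[of k] Suc.prems(1) by auto
qed

text \<open>At index \<open>n\<close> feedback enters with factor
  \<open>observed A (n - 1) B = 1\<close>, so the output drops by exactly \<open>W a(A) v\<close>.
  As \<open>a\<close> is monic, this cancels the whole sum.\<close>

lemma observed_Acl_annihilated:
  assumes v: "v \<in> carrier_vec n"
  shows "(\<Sum>k\<le>n. observed Acl k v * of_real (coeff a k)) = 0"
proof -
  obtain m where m: "n = Suc m" using n by (cases n) auto
  have "observed Acl n v = observed A m (Acl *\<^sub>v v)"
    using observed_Suc[OF Acl v, of m] observed_Acl[of m, OF _ mult_mat_vec_carrier[OF Acl v]] m by auto
  then have top: "observed Acl n v = observed A n v - (\<Sum>k\<le>n. observed A k v * of_real (coeff a k))"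
    using observed_Acl_step[OF v, of m] observed_B[of m] observed_gain[OF v] m by auto
  have "coeff a n = 1" using monic deg by simp
  moreover have "(\<Sum>k<n. observed Acl k v * of_real (coeff a k)) = (\<Sum>k<n. observed A k v * of_real (coeff a k))"
    using v by (simp add: observed_Acl)
  ultimately show ?thesis
    by (simp add: top lessThan_Suc_atMost[symmetric])
qed

text \<open>In the coordinates of \<open>v\<close> with respect to the columns \<open>A\<^sup>j B\<close> the hypothesis is an
  anti-triangular system with unit anti-diagonal.\<close>

lemma observable:
  assumes v: "v \<in> carrier_vec n" and zero: "\<And>k. k < n \<Longrightarrow> observed A k v = 0"
  shows "v = 0\<^sub>v n"
proof -
  let ?C = "ctrb_mat A B"
  define x where "x = inv_mat ?C *\<^sub>v v"
  have x: "x \<in> carrier_vec n"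
    unfolding x_def using inv_ctrb(1) v by (rule mult_mat_vec_carrier)
  have "?C *\<^sub>v x = v"
    using assoc_mult_mat_vec[OF ctrb_mat_carrier inv_ctrb(1) v] v by (simp add: x_def inv_ctrb(2))
  then have vx: "v = right_comb n n (\<lambda>j. A ^\<^sub>m j *\<^sub>v B) (($) x)"
    using A x by (simp add: ctrb_mat_def mat_of_cols_mult_vec pow_mat_mult_vec_carrier[OF A B])
  \<comment> \<open>The coordinates are eliminated from the last one downwards.\<close>
  have "k < n \<Longrightarrow> x $ (n - 1 - k) = 0" for k
  proof (induction k rule: less_induct)
    case (less k)
    have tail: "x $ j = 0" if "n - 1 - k < j" "j < n" for j
    proof -
      have "n - 1 - (n - 1 - j) = j" "n - 1 - j < k" using that by linarith+
      then show ?thesis using less.IH[of "n - 1 - j"] less.prems by simp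
    qed
    have "0 = observed A k v" using zero less.prems by simp
    also have "\<dots> = (\<Sum>j<n. observed A (k + j) B * x $ j)"
      unfolding vx by (simp add: observed_right_comb[OF A] pow_mat_mult_vec_carrier[OF A B] observed_pow[OF A B])
    also have "\<dots> = (\<Sum>j<n. if j = n - 1 - k then x $ j else 0)"
    proof (rule sum.cong)
      fix j assume j: "j \<in> {..<n}"
      \<comment> \<open>Below \<open>n\<close>, \<open>observed_B\<close> leaves only
        \<open>j = n - 1 - k\<close>. Where \<open>k + j\<close> reaches \<open>n\<close> it says
        nothing, but there \<open>x $ j\<close> is already 0.\<close>
      consider "k + j < n" | "n - 1 - k < j" using less.prems by linarith
      then show "observed A (k + j) B * x $ j = (if j = n - 1 - k then x $ j else 0)"
        using j tail by cases (auto simp: observed_B)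
    qed simp
    also have "\<dots> = x $ (n - 1 - k)" using n by simp
    finally show ?case by simp
  qed
  then have "x $ j = 0" if "j < n" for j
    using that \<open>\<And>k. k < n \<Longrightarrow> x $ (n - 1 - k) = 0\<close>[of "n - 1 - j"] by simp
  then show ?thesis
    unfolding vx by (intro eq_vecI) auto
qed

section \<open>Right eigenvalues of the closed loop and roots of \<open>a\<close>\<close>

lemma right_eigenvalue_imp_root:
  assumes v: "v \<in> carrier_vec n" "v \<noteq> 0\<^sub>v n" and eig: "Acl *\<^sub>v v = scale_right v l"
  shows "rpoly a l = 0"
proof (rule ccontr)
  assume nz: "rpoly a l \<noteq> 0"
  define w where "w = observed Acl 0 v"
  have out: "observed Acl k v = w * l ^ k" for k
  proof -
    have "observed Acl k v = observed Acl 0 (Acl ^\<^sub>m k *\<^sub>v v)"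
      using observed_pow[OF Acl v(1), of 0 k] by simp
    then show ?thesis
      by (simp add: pow_mat_eigenvector[OF Acl v(1) eig] observed_scale_right[OF Acl v(1)] w_def)
  qed
  \<comment> \<open>The outputs along \<open>v\<close> are geometric, so the annihilation becomes
    \<open>w * rpoly a l = 0\<close> in a division ring.\<close>
  have "w * rpoly a l = (\<Sum>k\<le>n. observed Acl k v * of_real (coeff a k))"
    by (simp add: rpoly_def deg out sum_distrib_left of_real_commute mult.assoc)
  then have "w = 0"
    using observed_Acl_annihilated[OF v(1)] nz by simp
  then have "observed A k v = 0" if "k < n" for k
    using out[of k] observed_Acl[OF that v(1)] by simp
  then show False using observable v by blast
qed

text \<open>Powers of \<open>Acl\<close> commute, so output \<open>j\<close> of
  \<open>a(Acl) B\<close> is the annihilated sum for the vector \<open>Acl^j B\<close>.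
  Observability then makes \<open>a(Acl) B\<close> vanish.\<close>

lemma Acl_poly_B:
  assumes "i < n"
  shows "(\<Sum>k\<le>n. (Acl ^\<^sub>m k *\<^sub>v B) $ i * of_real (coeff a k)) = 0"
proof -
  define u where "u = right_comb n (Suc n) (\<lambda>k. Acl ^\<^sub>m k *\<^sub>v B) (\<lambda>k. of_real (coeff a k))"
  have u: "u \<in> carrier_vec n" by (simp add: u_def)
  have "observed A j u = 0" if "j < n" for j
  proof -
    have "observed A j u = (\<Sum>k\<le>n. observed Acl (j + k) B * of_real (coeff a k))"
      using observed_Acl[OF that u]
      by (simp add: u_def observed_right_comb[OF Acl] pow_mat_mult_vec_carrier[OF Acl B] observed_pow[OF Acl B]
          lessThan_Suc_atMost)
    also have "\<dots> = (\<Sum>k\<le>n. observed Acl k (Acl ^\<^sub>m j *\<^sub>v B) * of_real (coeff a k))"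
      by (simp add: observed_pow[OF Acl B] add.commute)
    also have "\<dots> = 0"
      by (rule observed_Acl_annihilated[OF pow_mat_mult_vec_carrier[OF Acl B]])
    finally show ?thesis .
  qed
  then have "u $ i = 0" using observable[OF u] assms by simp
  then show ?thesis
    using assms by (simp add: u_def lessThan_Suc_atMost del: index_mult_mat_vec)
qed

text \<open>The coefficients \<open>d (Suc j)\<close> are those of the quotient of \<open>a(x) - a(l)\<close> by \<open>x - l\<close>; the
  quotient evaluated at the closed-loop matrix sends \<open>B\<close> to an eigenvector.\<close>

lemma root_imp_right_eigenvalue:
  assumes root: "rpoly a l = 0"
  obtains v where "v \<in> carrier_vec n" "v \<noteq> 0\<^sub>v n" "Acl *\<^sub>v v = scale_right v l"
proof -
  \<comment> \<open>Horner's scheme: \<open>d n\<close> is the leading coefficient,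
    \<open>d 0\<close> is \<open>rpoly a l\<close>.\<close>
  define d where "d j = (\<Sum>k\<in>{j..n}. of_real (coeff a k) * l ^ (k - j))" for j
  define v where "v = right_comb n n (\<lambda>j. Acl ^\<^sub>m j *\<^sub>v B) (\<lambda>j. d (Suc j))"
  have v: "v \<in> carrier_vec n" by (simp add: v_def)
  have dn: "d n = 1" using monic deg by (simp add: d_def)
  have d0: "d 0 = 0" using root deg by (simp add: d_def rpoly_def atLeast0AtMost)
  have d_step: "d (Suc j) * l = d j - of_real (coeff a j)" if "j \<le> n" for j
  proof -
    have "d j = of_real (coeff a j) + (\<Sum>k\<in>{Suc j..n}. of_real (coeff a k) * l ^ (k - j))"
      using that by (simp add: d_def sum.atLeast_Suc_atMost)
    moreover have "(\<Sum>k\<in>{Suc j..n}. of_real (coeff a k) * l ^ (k - j)) = d (Suc j) * l"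
      unfolding d_def sum_distrib_right
      by (intro sum.cong refl)
        (auto simp: mult.assoc power_Suc2[symmetric] Suc_diff_le[symmetric] simp del: power_Suc)
    ultimately show ?thesis by simp
  qed
  have "Acl *\<^sub>v v = right_comb n n (\<lambda>j. Acl ^\<^sub>m Suc j *\<^sub>v B) (\<lambda>j. d (Suc j))"
    using pow_mat_mult_vec_add[OF Acl B, of 1] Acl
    by (simp add: v_def mult_mat_vec_right_comb[OF Acl] pow_mat_mult_vec_carrier[OF Acl B])
  also have "\<dots> = scale_right v l"
  proof (intro eq_vecI)
    fix i assume "i < dim_vec (scale_right v l)"
    then have i: "i < n" using v by simp
    define g where "g k = (Acl ^\<^sub>m k *\<^sub>v B) $ i" for k
    have "scale_right v l $ i = (\<Sum>j<n. g j * (d (Suc j) * l))"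
      using i by (simp add: v_def g_def sum_distrib_right mult.assoc del: index_mult_mat_vec)
    also have "\<dots> = (\<Sum>j<n. g j * (d j - of_real (coeff a j)))"
      by (simp add: d_step)
    \<comment> \<open>The added term is 0, since \<open>d n\<close> and the leading coefficient are
      both 1.\<close>
    also have "\<dots> = (\<Sum>j\<le>n. g j * (d j - of_real (coeff a j)))"
      using dn monic deg by (simp add: lessThan_Suc_atMost[symmetric])
    also have "\<dots> = (\<Sum>j\<le>n. g j * d j)"
      using Acl_poly_B[OF i] by (simp add: right_diff_distrib sum_subtractf g_def)
    \<comment> \<open>The root hypothesis, as \<open>d 0 = 0\<close>, removes the first term and
      lets the index shift.\<close>
    also have "\<dots> = (\<Sum>j<n. g (Suc j) * d (Suc j))"
      using d0 by (simp add: lessThan_Suc_atMost[symmetric] sum.lessThan_Suc_shift del: sum.lessThan_Suc)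
    finally show "right_comb n n (\<lambda>j. Acl ^\<^sub>m Suc j *\<^sub>v B) (\<lambda>j. d (Suc j)) $ i = scale_right v l $ i"
      using i by (simp add: g_def del: index_mult_mat_vec pow_mat.simps)
  qed (use v in simp)
  finally have eig: "Acl *\<^sub>v v = scale_right v l" .
  \<comment> \<open>To see that \<open>v\<close> is nonzero, its output is computed: only
    \<open>j = n - 1\<close> survives and contributes \<open>d n = 1\<close>.\<close>
  have "observed Acl 0 v = (\<Sum>j<n. observed A j B * d (Suc j))"
    by (simp add: v_def observed_right_comb[OF Acl] pow_mat_mult_vec_carrier[OF Acl B] observed_pow[OF Acl B]
        observed_Acl B)
  also have "\<dots> = (\<Sum>j<n. if j = n - 1 then d (Suc j) else 0)"
    by (intro sum.cong) (auto simp: observed_B)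
  also have "\<dots> = 1" using n dn by simp
  finally have "observed Acl 0 v = 1" .
  moreover have "observed Acl 0 (0\<^sub>v n) = 0"
    using observed_diff[OF Acl zero_carrier_vec zero_carrier_vec, of 0] by simp
  ultimately have "v \<noteq> 0\<^sub>v n" by auto
  then show thesis using that v eig by blast
qed

text \<open>The two conditions are equivalent for each individual quaternion \<open>l\<close>;
  taking classes yields equal sets.\<close>

lemma right_spectrum_Acl: "right_spectrum Acl = {sim_class l | l. rpoly a l = 0}"
proof -
  have "(\<exists>v \<in> carrier_vec n. v \<noteq> 0\<^sub>v n \<and> Acl *\<^sub>v v = map_vec (\<lambda>x. x * l) v) \<longleftrightarrow> rpoly a l = 0" for l
    using right_eigenvalue_imp_root root_imp_right_eigenvalue unfolding scale_right_def by metis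
  then show ?thesis using Acl by (simp add: right_spectrum_def)
qed

end

theorem theorem6:
  fixes n :: nat and A :: "quat mat" and B :: "quat vec" and a :: "real poly"
    and K A_cl :: "quat mat"
  assumes "n \<ge> 1"
    and "A \<in> carrier_mat n n"
    and "B \<in> carrier_vec n"
    and "controllable A B"
    and "degree a = n" and "lead_coeff a = 1"
    and "K = ackermann_gain A B a"
    and "A_cl = A - mat_of_cols n [B] * K"
  shows "right_spectrum A_cl = {sim_class l | l. rpoly a l = 0} \<and>
    (\<forall>m (l :: nat \<Rightarrow> quat).
        (\<forall>i<m. rpoly a (l i) = 0) \<and>
        (\<forall>i<m. \<forall>j<m. i \<noteq> j \<longrightarrow> sim_class (l i) \<noteq> sim_class (l j)) \<and>
        (\<forall>q. rpoly a q = 0 \<longrightarrow> (\<exists>i<m. sim_class q = sim_class (l i)))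
        \<longrightarrow> right_spectrum A_cl = {sim_class (l i) | i. i < m})"
proof -
  interpret ackermann n A B a
    using assms by unfold_locales
  have spec: "right_spectrum A_cl = {sim_class l | l. rpoly a l = 0}"
    using right_spectrum_Acl assms by (simp add: Acl_def)
  show ?thesis
  proof (intro conjI allI impI spec)
    fix m and l :: "nat \<Rightarrow> quat"
    assume l: "(\<forall>i<m. rpoly a (l i) = 0) \<and>
        (\<forall>i<m. \<forall>j<m. i \<noteq> j \<longrightarrow> sim_class (l i) \<noteq> sim_class (l j)) \<and>
        (\<forall>q. rpoly a q = 0 \<longrightarrow> (\<exists>i<m. sim_class q = sim_class (l i)))"
    have "sim_class q \<in> {sim_class (l i) | i. i < m}" if "rpoly a q = 0" for q
      using l that by fast
    moreover have "sim_class (l i) \<in> {sim_class q | q. rpoly a q = 0}" if "i < m" for i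
      using l that by fast
    ultimately show "right_spectrum A_cl = {sim_class (l i) | i. i < m}"
      unfolding spec by fastforce
  qed
qed

end
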